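(* Let $\mathcal{M}$ be a constrained Markov decision process with true transition kernel $p$, and let $k_*$ be its minimal required budget. Define iterates $k_n:\mathcal{S}\times\mathcal{A}\to\mathbb{N}\cup\{\infty\}$ by $k_0(s,a)=0$ for all $(s,a)$ and, for $n\ge 0$ and all $(s,a)\in\mathcal{S}\times\mathcal{A}$, $$k_{n+1}(s,a)=\max_{s':\,p(s'\mid s,a)>0}\Big[\mathbf{1}\{p(d=1\mid s,a,s')>0\}+\min_{a'\in\mathcal{A}}k_n(s',a')\Big].$$ Then for every $(s,a)\in\mathcal{S}\times\mathcal{A}$ the limit $k_\infty(s,a):=\lim_{n\to\infty}k_n(s,a)$ (in $\mathbb{N}\cup\{\infty\}$) satisfies $$k_\infty(s,a)=k_*(s,a).$$
   Context: A constrained Markov decision process (CMDP) $\mathcal{M}=(\mathcal{S},\mathcal{A},p,r,d)$ has a finite state set $\mathcal{S}$, a finite action set $\mathcal{A}$, and a transition kernel $p(s',r,d\mid s,a)$ giving the joint conditional law of the next state $S_{t+1}=s'$, the reward $R_{t+1}=r\in\mathbb{R}$ and the binary damage indicator $D_{t+1}=d\in\{0,1\}$ given $S_t=s,A_t=a$; $p(s'\mid s,a)$ and $p(d\mid s,a,s')$ are the corresponding marginal and conditional probabilities. Standing assumptions: there is an absorbing termination state in which the system remains with no further reward, and it is eventually reached under any policy. The budget evolves as $K_{t+1}=K_t-D_{t+1}$. A stationary (memory) policy $\tilde\pi$ chooses $A_t$ from a distribution $\tilde\pi(\cdot\mid S_t,K_t)$ on $\mathcal{A}$ (choices at negative budgets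 arbitrary). For $k\in\mathbb{N}\cup\{\infty\}$ the barrier function is $$B_{\tilde\pi}(s,k,a)=\mathbb{E}_{\tilde\pi}\Big[\mathbb{I}\Big\{\sum_{\ell=t}^\infty D_{\ell+1}\le K_t\Big\}\,\Big|\,S_t=s,K_t=k,A_t=a\Big],$$ where $\mathbb{I}\{x\}=0$ if $x$ is true and $-\infty$ otherwise; so $B_{\tilde\pi}(s,k,a)=0$ if the total future damage is at most $k$ with probability one and $-\infty$ otherwise. The optimal barrier function is $B_*(s,k,a)=\max_{\tilde\pi}B_{\tilde\pi}(s,k,a)$ over stationary memory policies. The minimal required budget is $k_*(s,a)=\min\{k\in\{0,1,2,\dots\}\cup\{\infty\}: B_*(s,k,a)=0\}$ (the value $\infty$ is allowed). *)

theory Defs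
  imports "HOL-Probability.Probability"
begin

text \<open>
  States and actions range over finite types. The transition kernel maps a state-action pair to
  the joint law of (next state, reward, damage). It is a general probability measure, since the
  reward need not be discrete. Its marginal and conditional on next state and damage are recovered
  by the usual formulas.
\<close>

type_synonym ('s, 'a) kernel = "'s \<Rightarrow> 'a \<Rightarrow> ('s \<times> real \<times> bool) measure"

definition outcome_space :: "('s \<times> real \<times> bool) measure" where
  "outcome_space = count_space UNIV \<Otimes>\<^sub>M borel \<Otimes>\<^sub>M count_space UNIV"

definition next_prob :: "('s, 'a) kernel \<Rightarrow> 's \<Rightarrow> 'a \<Rightarrow> 's \<Rightarrow> real" where
  "next_prob p s a s' = \<P>((x, r, d) in p s a. x = s')"

definition damage_prob :: "('s, 'a) kernel \<Rightarrow> 's \<Rightarrow> 'a \<Rightarrow> 's \<Rightarrow> real" where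
  "damage_prob p s a s' = cond_prob (p s a) (\<lambda>(x, r, d). d) (\<lambda>(x, r, d). x = s')"

text \<open>
  The running budget may become negative once it is overspent, and it stays infinite if it
  starts infinite.
\<close>

datatype budget = Finite_Budget int | Infinite_Budget

instance budget :: countable
  by countable_datatype

fun budget_of_enat :: "enat \<Rightarrow> budget" where
  "budget_of_enat (enat n) = Finite_Budget (int n)"
| "budget_of_enat \<infinity> = Infinite_Budget"

fun spend :: "budget \<Rightarrow> bool \<Rightarrow> budget" where
  "spend (Finite_Budget i) d = Finite_Budget (i - of_bool d)"
| "spend Infinite_Budget d = Infinite_Budget"

type_synonym ('s, 'a) policy = "'s \<Rightarrow> budget \<Rightarrow> 'a pmf"

text \<open>
  The record of time \<open>n\<close> is \<open>(S\<^sub>n, K\<^sub>n, A\<^sub>n, R\<^sub>n, D\<^sub>n)\<close>. The reward and damage of time \<open>0\<close>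
  precede the first transition. They are placeholders that are never used.
\<close>

type_synonym ('s, 'a) step = "'s \<times> budget \<times> 'a \<times> real \<times> bool"

definition step_space :: "('s, 'a) step measure" where
  "step_space = count_space UNIV \<Otimes>\<^sub>M count_space UNIV \<Otimes>\<^sub>M count_space UNIV \<Otimes>\<^sub>M borel \<Otimes>\<^sub>M count_space UNIV"

definition state_of :: "('s, 'a) step \<Rightarrow> 's" where
  "state_of = (\<lambda>(s, k, a, r, d). s)"

definition damage_of :: "('s, 'a) step \<Rightarrow> bool" where
  "damage_of = (\<lambda>(s, k, a, r, d). d)"

definition step_kernel ::
    "('s, 'a) kernel \<Rightarrow> ('s, 'a) policy \<Rightarrow> ('s, 'a) step \<Rightarrow> ('s, 'a) step measure" where
  "step_kernel p \<pi> = (\<lambda>(s, k, a, _, _).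
     p s a \<bind> (\<lambda>(s', r, d).
       measure_pmf (\<pi> s' (spend k d)) \<bind> (\<lambda>a'.
         return step_space (s', spend k d, a', r, d))))"

text \<open>
  The law of the whole trajectory started from \<open>S\<^sub>0 = s\<close>, \<open>K\<^sub>0 = k\<close>, \<open>A\<^sub>0 = a\<close>, obtained from the
  Ionescu-Tulcea theorem. The first action is prescribed, whether or not \<open>\<pi>\<close> would choose it.
  By time homogeneity this is also the conditional law of the process from time \<open>t\<close>
  given \<open>S\<^sub>t = s\<close>, \<open>K\<^sub>t = k\<close>, \<open>A\<^sub>t = a\<close>.
\<close>

definition history_kernel ::
    "('s, 'a) kernel \<Rightarrow> ('s, 'a) policy \<Rightarrow> 's \<Rightarrow> budget \<Rightarrow> 'a \<Rightarrow>
      nat \<Rightarrow> (nat \<Rightarrow> ('s, 'a) step) \<Rightarrow> ('s, 'a) step measure" where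
  "history_kernel p \<pi> s k a n \<omega> =
     (case n of 0 \<Rightarrow> return step_space (s, k, a, 0, False) | Suc m \<Rightarrow> step_kernel p \<pi> (\<omega> m))"

definition trajectory ::
    "('s, 'a) kernel \<Rightarrow> ('s, 'a) policy \<Rightarrow> 's \<Rightarrow> enat \<Rightarrow> 'a \<Rightarrow>
      (nat \<Rightarrow> ('s, 'a) step) measure" where
  "trajectory p \<pi> s k a =
     projective_family.lim UNIV
       (Ionescu_Tulcea.CI (history_kernel p \<pi> s (budget_of_enat k) a) (\<lambda>_. step_space))
       (\<lambda>_. step_space)"

text \<open>
  Termination concerns every initial state, budget and action and every stationary memory policy.
  Damage in the termination state is not excluded.
\<close>

locale cmdp =
  fixes p :: "('s :: finite, 'a :: finite) kernel" and z :: 's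
  assumes kernel: "p s a \<in> space (prob_algebra outcome_space)"
    and absorbing: "AE (s', r, d) in p z a. s' = z \<and> r = 0"
    and terminates: "AE \<omega> in trajectory p \<pi> s k a. \<exists>n. state_of (\<omega> n) = z"

definition barrier_indicator :: "bool \<Rightarrow> ereal" where
  "barrier_indicator b = (if b then 0 else - \<infinity>)"

text \<open>
  The expectation of a nonpositive extended real variable is the negative of the
  nonnegative integral of its negative.
\<close>

definition barrier ::
    "('s, 'a) kernel \<Rightarrow> ('s, 'a) policy \<Rightarrow> 's \<Rightarrow> enat \<Rightarrow> 'a \<Rightarrow> ereal" where
  "barrier p \<pi> s k a =
     - enn2ereal (\<integral>\<^sup>+ \<omega>. e2ennreal (- barrier_indicator
         ((\<Sum>l. of_bool (damage_of (\<omega> (Suc l)))) \<le> ennreal_of_enat k)) \<partial>trajectory p \<pi> s k a)"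

text \<open>The supremum is a maximum: see \<open>opt_barrier_attained\<close> below.\<close>

definition opt_barrier :: "('s, 'a) kernel \<Rightarrow> 's \<Rightarrow> enat \<Rightarrow> 'a \<Rightarrow> ereal" where
  "opt_barrier p s k a = (SUP \<pi>. barrier p \<pi> s k a)"

definition min_budget :: "('s, 'a) kernel \<Rightarrow> 's \<Rightarrow> 'a \<Rightarrow> enat" where
  "min_budget p s a = (LEAST k. opt_barrier p s k a = 0)"

primrec budget_iter :: "('s, 'a) kernel \<Rightarrow> nat \<Rightarrow> 's \<Rightarrow> 'a \<Rightarrow> enat" where
  "budget_iter p 0 = (\<lambda>s a. 0)"
| "budget_iter p (Suc n) = (\<lambda>s a.
     MAX s' \<in> {s'. next_prob p s a s' > 0}.
       of_bool (damage_prob p s a s' > 0) + (MIN a'. budget_iter p n s' a'))"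


section \<open>The trajectory measure is well defined\<close>

lemma space_step_space [simp]: "space step_space = UNIV"
  by (simp add: step_space_def space_pair_measure)

lemma space_outcome_space [simp]: "space outcome_space = UNIV"
  by (simp add: outcome_space_def space_pair_measure)

lemma measurable_step_kernel:
  fixes p :: "('s :: finite, 'a :: finite) kernel"
  assumes "\<And>s a. p s a \<in> space (prob_algebra outcome_space)"
  shows "step_kernel p \<pi> \<in> step_space \<rightarrow>\<^sub>M prob_algebra step_space"
proof -
  have pmf: "(\<lambda>x::'s \<times> bool. measure_pmf (\<pi> (fst x) (spend k (snd x))))
      \<in> count_space UNIV \<rightarrow>\<^sub>M prob_algebra (count_space UNIV)" for k
    by (auto simp: space_prob_algebra measure_pmf.prob_space_axioms)
  have proj: "(\<lambda>x. (fst x, snd (snd x))) \<in> outcome_space \<rightarrow>\<^sub>M count_space (UNIV :: ('s \<times> bool) set)"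
  proof -
    have "(\<lambda>x. (fst x, snd (snd x))) \<in> outcome_space \<rightarrow>\<^sub>M
        (count_space UNIV \<Otimes>\<^sub>M count_space UNIV :: ('s \<times> bool) measure)"
      unfolding outcome_space_def by measurable
    then show ?thesis
      by (simp add: pair_measure_countable)
  qed
  have ret: "(\<lambda>x. return step_space (fst (fst x), spend k (snd (snd (fst x))), snd x,
        fst (snd (fst x)), snd (snd (fst x)))) \<in> outcome_space \<Otimes>\<^sub>M count_space (UNIV :: 'a set) \<rightarrow>\<^sub>M prob_algebra step_space"
    for k
    by (rule measurable_compose[OF _ measurable_return_prob_space])
      (unfold step_space_def outcome_space_def, measurable)
  have inner: "(\<lambda>y. measure_pmf (\<pi> (fst y) (spend k (snd (snd y)))) \<bind> (\<lambda>a'.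
         return step_space (fst y, spend k (snd (snd y)), a', fst (snd y), snd (snd y))))
       \<in> outcome_space \<rightarrow>\<^sub>M prob_algebra step_space" for k
    by (rule measurable_bind_prob_space2[OF measurable_compose[OF proj pmf, simplified]])
      (use ret in \<open>simp add: split_beta'\<close>)
  have body: "p s a \<bind> (\<lambda>y. measure_pmf (\<pi> (fst y) (spend k (snd (snd y)))) \<bind> (\<lambda>a'.
         return step_space (fst y, spend k (snd (snd y)), a', fst (snd y), snd (snd y))))
       \<in> space (prob_algebra step_space)" for s a k
  proof -
    have "(\<lambda>_::unit. p s a \<bind> (\<lambda>y. measure_pmf (\<pi> (fst y) (spend k (snd (snd y)))) \<bind> (\<lambda>a'.
         return step_space (fst y, spend k (snd (snd y)), a', fst (snd y), snd (snd y)))))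
        \<in> count_space UNIV \<rightarrow>\<^sub>M prob_algebra step_space"
      by (rule measurable_bind_prob_space[OF _ inner]) (simp add: assms)
    then show ?thesis
      by (auto simp: Pi_iff simp del: prod.collapse)
  qed
  have c: "(\<lambda>(s, k, a). p s a \<bind> (\<lambda>y. measure_pmf (\<pi> (fst y) (spend k (snd (snd y)))) \<bind> (\<lambda>a'.
         return step_space (fst y, spend k (snd (snd y)), a', fst (snd y), snd (snd y)))))
       \<in> count_space UNIV \<rightarrow>\<^sub>M prob_algebra step_space"
    using body by auto
  have t: "(\<lambda>x. (fst x, fst (snd x), fst (snd (snd x)))) \<in> step_space \<rightarrow>\<^sub>M
      count_space (UNIV :: ('s \<times> budget \<times> 'a) set)"
  proof -
    have "(\<lambda>x. (fst x, fst (snd x), fst (snd (snd x)))) \<in> step_space \<rightarrow>\<^sub>M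
      (count_space UNIV \<Otimes>\<^sub>M count_space UNIV \<Otimes>\<^sub>M count_space UNIV :: ('s \<times> budget \<times> 'a) measure)"
      unfolding step_space_def by measurable
    then show ?thesis
      by (simp add: pair_measure_countable)
  qed
  from measurable_compose[OF t c] show ?thesis
    by (simp add: step_kernel_def[abs_def] split_beta')
qed

context
  fixes p :: "('s :: finite, 'a :: finite) kernel"
  assumes kernel: "\<And>s a. p s a \<in> space (prob_algebra outcome_space)"
begin

lemma Ionescu_Tulcea_history_kernel:
  "Ionescu_Tulcea (history_kernel p \<pi> s k a) (\<lambda>_. step_space)"
proof -
  have m: "history_kernel p \<pi> s k a i \<in> PiM {0..<i} (\<lambda>_. step_space) \<rightarrow>\<^sub>M prob_algebra step_space" for i
  proof (cases i)
    case 0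
    then show ?thesis
      by (auto simp: history_kernel_def[abs_def] space_prob_algebra prob_space_return)
  next
    case (Suc m)
    have "(\<lambda>\<omega>. \<omega> m) \<in> PiM {0..<i} (\<lambda>_. step_space) \<rightarrow>\<^sub>M step_space"
      using Suc by (intro measurable_component_singleton) auto
    from measurable_compose[OF this measurable_step_kernel[OF kernel]] show ?thesis
      by (simp add: history_kernel_def[abs_def] Suc)
  qed
  show ?thesis
  proof (rule Ionescu_Tulcea.intro)
    show "history_kernel p \<pi> s k a i \<in> PiM {0..<i} (\<lambda>_. step_space) \<rightarrow>\<^sub>M subprob_algebra step_space" for i
      using m by (rule measurable_prob_algebraD)
    show "prob_space (history_kernel p \<pi> s k a i x)"
      if "x \<in> space (PiM {0..<i} (\<lambda>_. step_space))" for i x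
      using measurable_space[OF m that] by (simp add: space_prob_algebra)
  qed
qed

lemma prob_space_trajectory: "prob_space (trajectory p \<pi> s k a)"
proof -
  interpret Ionescu_Tulcea "history_kernel p \<pi> s (budget_of_enat k) a" "\<lambda>_. step_space"
    by (rule Ionescu_Tulcea_history_kernel)
  show ?thesis
    unfolding trajectory_def
  proof (rule prob_space_distrD)
    show "(\<lambda>\<omega>. restrict \<omega> {}) \<in> PF.lim \<rightarrow>\<^sub>M PiM {} (\<lambda>_. step_space)"
      by (auto simp: measurable_cong_sets[OF PF.sets_lim refl] intro!: measurable_restrict)
    show "prob_space (distr PF.lim (PiM {} (\<lambda>_. step_space)) (\<lambda>\<omega>. restrict \<omega> {}))"
      unfolding distr_lim[OF finite.emptyI] by (rule PF.prob_space_P) auto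
  qed
qed

lemma sets_trajectory: "sets (trajectory p \<pi> s k a) = sets (PiM UNIV (\<lambda>_. step_space))"
proof -
  interpret Ionescu_Tulcea "history_kernel p \<pi> s (budget_of_enat k) a" "\<lambda>_. step_space"
    by (rule Ionescu_Tulcea_history_kernel)
  show ?thesis
    unfolding trajectory_def by (rule PF.sets_lim)
qed

lemma distr_trajectory:
  assumes "finite J"
  shows "distr (trajectory p \<pi> s k a) (PiM J (\<lambda>_. step_space)) (\<lambda>\<omega>. restrict \<omega> J) =
    Ionescu_Tulcea.CI (history_kernel p \<pi> s (budget_of_enat k) a) (\<lambda>_. step_space) J"
proof -
  interpret Ionescu_Tulcea "history_kernel p \<pi> s (budget_of_enat k) a" "\<lambda>_. step_space"
    by (rule Ionescu_Tulcea_history_kernel)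
  show ?thesis
    unfolding trajectory_def using assms by (rule distr_lim)
qed

lemma barrier_eq:
  "barrier p \<pi> s k a =
    (if AE \<omega> in trajectory p \<pi> s k a. (\<Sum>l. of_bool (damage_of (\<omega> (Suc l)))) \<le> ennreal_of_enat k
     then 0 else - \<infinity>)"
proof -
  let ?M = "trajectory p \<pi> s k a"
  let ?Q = "\<lambda>\<omega>::nat \<Rightarrow> ('s, 'a) step.
    (\<Sum>l. of_bool (damage_of (\<omega> (Suc l)))) \<le> ennreal_of_enat k"
  interpret prob_space ?M by (rule prob_space_trajectory)
  have [measurable]: "Measurable.pred step_space (damage_of :: ('s, 'a) step \<Rightarrow> bool)"
    unfolding damage_of_def step_space_def by measurable
  have "Measurable.pred (PiM UNIV (\<lambda>_. step_space)) ?Q"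
    by measurable
  then have Q [measurable]: "Measurable.pred ?M ?Q"
    by (simp add: measurable_cong_sets[OF sets_trajectory refl])
  have "(\<integral>\<^sup>+ \<omega>. e2ennreal (- barrier_indicator (?Q \<omega>)) \<partial>?M)
      = (\<integral>\<^sup>+ \<omega>. \<infinity> * indicator {\<omega> \<in> space ?M. \<not> ?Q \<omega>} \<omega> \<partial>?M)"
    by (intro nn_integral_cong) (auto simp: barrier_indicator_def zero_ereal_def[symmetric] zero_ennreal_def[symmetric]
        infinity_ennreal_def top_ennreal.abs_eq[symmetric] e2ennreal_infty)
  also have "\<dots> = \<infinity> * emeasure ?M {\<omega> \<in> space ?M. \<not> ?Q \<omega>}"
    by (subst nn_integral_cmult_indicator) auto
  also have "\<dots> = (if AE \<omega> in ?M. ?Q \<omega> then 0 else \<infinity>)"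
    by (auto simp: AE_iff_measurable[OF _ refl] ennreal_top_mult)
  finally show ?thesis
    by (auto simp: barrier_def zero_ennreal.rep_eq)
qed

lemma opt_barrier_attained: "\<exists>\<pi>. barrier p \<pi> s k a = opt_barrier p s k a"
proof -
  have "range (\<lambda>\<pi>. barrier p \<pi> s k a) \<subseteq> {0, - \<infinity>}"
    by (auto simp: barrier_eq)
  then have "finite (range (\<lambda>\<pi>. barrier p \<pi> s k a))"
    by (rule finite_subset) simp
  then have "Sup (range (\<lambda>\<pi>. barrier p \<pi> s k a)) \<in> range (\<lambda>\<pi>. barrier p \<pi> s k a)"
    using Max_in[of "range (\<lambda>\<pi>. barrier p \<pi> s k a)"] Max_Sup[of "range (\<lambda>\<pi>. barrier p \<pi> s k a)"]
    by simp
  then show ?thesis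
    unfolding opt_barrier_def by fastforce
qed

end

end

theory Submission
  imports Defs
begin

text \<open>
  If a policy keeps the damage from \<open>(s, k, a)\<close> almost surely within \<open>k\<close>, then every configuration
  reached with positive probability has a nonnegative budget, and by induction on \<open>n\<close> this
  budget is at least \<open>k\<^sub>n\<close> of the current state and action: one more step costs the possible
  damage, and whatever action the policy takes next needs at least the minimum over all actions.
  Hence \<open>k\<^sub>\<infinity> \<le> k\<^sub>*\<close>. Conversely \<open>k\<^sub>\<infinity>\<close> satisfies the limiting recursion because there are finitely
  many actions, so acting greedily for \<open>k\<^sub>\<infinity>\<close> from budget \<open>k\<^sub>\<infinity>(s, a)\<close> keeps the budget above \<open>k\<^sub>\<infinity>\<close>
  forever.
\<close>

section \<open>Almost sure one-step properties\<close>

context Ionescu_Tulcea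
begin

text \<open>An event about the first \<open>n\<close> coordinates depends only on the marginal of
  the limit there, and this marginal is the \<open>n\<close>-fold composition of the
  kernels.\<close>

lemma AE_lim_iff_AE_C:
  assumes Q [measurable]: "Measurable.pred (PiM {0..<n} M) Q"
  shows "(AE \<omega> in PF.lim. Q (restrict \<omega> {0..<n})) \<longleftrightarrow> (AE \<omega> in C 0 n (\<lambda>_. undefined). Q \<omega>)"
proof -
  have up: "up_to {0..<n} = n"
    by (rule antisym) (use up_to[of "{0..<n}"] in \<open>auto simp: up_to_iff\<close>)
  have "(\<lambda>\<omega>. restrict \<omega> {0..<n}) \<in> PF.lim \<rightarrow>\<^sub>M PiM {0..<n} M"
    by (subst measurable_cong_sets[OF PF.sets_lim refl]) (rule measurable_restrict_subset, simp)
  then have "(AE \<omega> in PF.lim. Q (restrict \<omega> {0..<n})) \<longleftrightarrow> (AE \<omega> in CI {0..<n}. Q \<omega>)"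
    by (subst distr_lim[symmetric]) (auto simp: AE_distr_iff)
  also have "\<dots> \<longleftrightarrow> (AE \<omega> in C 0 n (\<lambda>_. undefined). Q \<omega>)"
    unfolding CI_def up by (subst distr_C[of n n "\<lambda>_. undefined" 0, simplified, symmetric]) (rule refl)
  finally show ?thesis .
qed

text \<open>\<open>C 0 (Suc n)\<close> is \<open>C 0 n\<close> followed by \<open>eP n\<close>, and
  \<open>eP n\<close> appends a coordinate drawn from \<open>P n\<close>. So almost sure statements
  about the limit can be checked one kernel at a time.\<close>

lemma AE_lim_Suc_iff:
  assumes Q [measurable]: "Measurable.pred (PiM {0..<Suc n} M) Q"
  shows "(AE \<omega> in PF.lim. Q (restrict \<omega> {0..<Suc n})) \<longleftrightarrow>
    (AE \<omega> in PF.lim. AE x in P n (restrict \<omega> {0..<n}). Q ((restrict \<omega> {0..<n})(n := x)))"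
proof -
  have "(AE \<omega> in PF.lim. Q (restrict \<omega> {0..<Suc n})) \<longleftrightarrow>
      (AE \<omega> in C 0 n (\<lambda>_. undefined) \<bind> eP n. Q \<omega>)"
    using AE_lim_iff_AE_C[OF Q] unfolding C.simps add_0 .
  also have "\<dots> \<longleftrightarrow> (AE \<omega> in C 0 n (\<lambda>_. undefined). AE \<omega>' in eP n \<omega>. Q \<omega>')"
    by (rule AE_bind[where B = "PiM {0..<Suc n} M"])
      (use measurable_eP in \<open>auto simp: measurable_cong_sets[OF sets_C refl]\<close>)
  also have "\<dots> \<longleftrightarrow> (AE \<omega> in PF.lim. AE \<omega>' in eP n (restrict \<omega> {0..<n}). Q \<omega>')"
  proof (rule AE_lim_iff_AE_C[symmetric])
    \<comment> \<open>The inner almost sure statement must be a measurable predicate of the history;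
      it says that \<open>eP n\<close> gives \<open>?N\<close> mass 0, which is measurable.\<close>
    let ?N = "{\<omega> \<in> space (PiM {0..<Suc n} M). \<not> Q \<omega>}"
    have "Measurable.pred (PiM {0..<n} M) (\<lambda>\<omega>. emeasure (eP n \<omega>) ?N = 0)"
      by measurable
    then show "Measurable.pred (PiM {0..<n} M) (\<lambda>\<omega>. AE \<omega>' in eP n \<omega>. Q \<omega>')"
      by (subst measurable_cong[where g = "\<lambda>\<omega>. emeasure (eP n \<omega>) ?N = 0"])
        (simp_all add: AE_iff_measurable[OF _ refl] space_eP sets_eP)
  qed
  also have "\<dots> \<longleftrightarrow> (AE \<omega> in PF.lim. AE x in P n (restrict \<omega> {0..<n}). Q ((restrict \<omega> {0..<n})(n := x)))"
  proof (rule AE_cong)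
    fix \<omega> assume "\<omega> \<in> space PF.lim"
    then have \<omega>: "restrict \<omega> {0..<n} \<in> space (PiM {0..<n} M)"
      by (auto simp: PF.space_lim space_PiM)
    show "(AE \<omega>' in eP n (restrict \<omega> {0..<n}). Q \<omega>') \<longleftrightarrow>
        (AE x in P n (restrict \<omega> {0..<n}). Q ((restrict \<omega> {0..<n})(n := x)))"
      unfolding eP_def
      by (rule AE_distr_iff)
        (use \<omega> in \<open>auto intro!: measurable_fun_upd[where J = "{0..<n}"] simp: measurable_cong_sets[OF sets_P refl]\<close>)
  qed
  finally show ?thesis .
qed

end

text \<open>The reward is left out so that configurations form a countable type: every predicate on
  them is measurable, and the next step depends on the current record through its configuration
  alone.\<close>

definition config_of :: "('s, 'a) step \<Rightarrow> 's \<times> budget \<times> 'a" where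
  "config_of = (\<lambda>(s, k, a, r, d). (s, k, a))"

text \<open>This is the support of the joint marginal of next state and damage. The recursion
  depends on \<open>p\<close> only through it.\<close>

definition possible :: "('s, 'a) kernel \<Rightarrow> 's \<Rightarrow> 'a \<Rightarrow> ('s \<times> bool) set" where
  "possible p s a = {(s', d). \<P>(y in p s a. fst y = s' \<and> snd (snd y) = d) > 0}"

lemma measurable_config_of [measurable]:
  "config_of \<in> step_space \<rightarrow>\<^sub>M count_space (UNIV :: ('s :: finite \<times> budget \<times> 'a :: finite) set)"
proof -
  have "config_of \<in> step_space \<rightarrow>\<^sub>M
      (count_space UNIV \<Otimes>\<^sub>M count_space UNIV \<Otimes>\<^sub>M count_space UNIV :: ('s \<times> budget \<times> 'a) measure)"
    unfolding step_space_def config_of_def split_beta' by measurable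
  then show ?thesis
    by (simp add: pair_measure_countable)
qed

lemma measurable_damage_of [measurable]: "Measurable.pred step_space damage_of"
  unfolding damage_of_def step_space_def by measurable

lemma measurable_outcome [measurable]:
  "(\<lambda>(x, r, d). (x, d)) \<in> outcome_space \<rightarrow>\<^sub>M count_space (UNIV :: ('s :: finite \<times> bool) set)"
proof -
  have "(\<lambda>(x, r, d). (x, d)) \<in> outcome_space \<rightarrow>\<^sub>M
      (count_space UNIV \<Otimes>\<^sub>M count_space UNIV :: ('s \<times> bool) measure)"
    unfolding outcome_space_def split_beta' by measurable
  then show ?thesis
    by (simp add: pair_measure_countable)
qed

section \<open>Almost sure statements about one transition\<close>

context
  fixes p :: "('s :: finite, 'a :: finite) kernel"
  assumes kernel: "\<And>s a. p s a \<in> space (prob_algebra outcome_space)"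
begin

lemma prob_space_kernel: "prob_space (p s a)"
  and sets_kernel_outcome: "sets (p s a) = sets outcome_space"
  and space_kernel_outcome: "space (p s a) = UNIV"
  using kernel[of s a] sets_eq_imp_space_eq[of "p s a" outcome_space]
  by (auto simp: space_prob_algebra)

lemma measurable_kernel_outcome:
  "(\<lambda>(x, r, d). (x, d)) \<in> p s a \<rightarrow>\<^sub>M count_space (UNIV :: ('s \<times> bool) set)"
  using measurable_outcome by (simp add: measurable_cong_sets[OF sets_kernel_outcome refl])

lemma sets_kernel_Collect: "{y. Q (fst y) (snd (snd y))} \<in> sets (p s a)"
  for Q :: "'s \<Rightarrow> bool \<Rightarrow> bool"
proof -
  have "{y. Q (fst y) (snd (snd y))} = (\<lambda>(x, r, d). (x, d)) -` {c. Q (fst c) (snd c)} \<inter> space (p s a)"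
    unfolding vimage_def space_kernel_outcome split_beta' by simp
  then show ?thesis
    using measurable_sets[OF measurable_kernel_outcome, of "{c. Q (fst c) (snd c)}" s a] by simp
qed

text \<open>Next state and damage take finitely many values, so a property holds almost surely
  exactly when each violating value has probability 0.\<close>

lemma AE_kernel_iff: "(AE (x, r, d) in p s a. Q x d) \<longleftrightarrow> (\<forall>(x, d) \<in> possible p s a. Q x d)"
proof -
  interpret prob_space "p s a" by (rule prob_space_kernel)
  let ?f = "\<lambda>y. (fst y, snd (snd y))"
  \<comment> \<open>Writing the property as avoidance of each violating value lets the quantifier be
    pulled out of the almost sure statement.\<close>
  have avoid: "P c \<longleftrightarrow> (\<forall>c' \<in> {c. \<not> P c}. c \<noteq> c')" for P :: "'s \<times> bool \<Rightarrow> bool" and c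
    by blast
  have "(AE y in p s a. Q (fst y) (snd (snd y))) \<longleftrightarrow>
      (AE y in p s a. \<forall>c \<in> {c. \<not> Q (fst c) (snd c)}. ?f y \<noteq> c)"
    by (intro AE_cong, subst avoid[of "\<lambda>c. Q (fst c) (snd c)", symmetric]) (simp only: fst_conv snd_conv)
  also have "\<dots> \<longleftrightarrow> (\<forall>c \<in> {c. \<not> Q (fst c) (snd c)}. AE y in p s a. ?f y \<noteq> c)"
    by (rule AE_ball_countable) auto
  also have "\<dots> \<longleftrightarrow> (\<forall>c \<in> {c. \<not> Q (fst c) (snd c)}. c \<notin> possible p s a)"
  proof (intro ball_cong refl)
    fix c :: "'s \<times> bool"
    have "(AE y in p s a. ?f y \<noteq> c) \<longleftrightarrow> \<P>(y in p s a. ?f y = c) = 0"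
      using sets_kernel_Collect[of "\<lambda>x d. (x, d) = c" s a]
      by (subst prob_Collect_eq_0) (auto simp: space_kernel_outcome)
    also have "\<dots> \<longleftrightarrow> c \<notin> possible p s a"
      by (cases c) (simp add: possible_def zero_less_measure_iff)
    finally show "(AE y in p s a. ?f y \<noteq> c) \<longleftrightarrow> c \<notin> possible p s a" .
  qed
  also have "\<dots> \<longleftrightarrow> (\<forall>c \<in> possible p s a. Q (fst c) (snd c))"
    by blast
  finally show ?thesis
    unfolding split_beta' .
qed

lemma next_prob_pos_iff: "next_prob p s a s' > 0 \<longleftrightarrow> (\<exists>d. (s', d) \<in> possible p s a)"
proof -
  interpret prob_space "p s a" by (rule prob_space_kernel)
  have "next_prob p s a s' = \<P>(y in p s a. fst y = s')"
    unfolding next_prob_def by (intro arg_cong[where f = prob]) auto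
  also have "\<dots> = 0 \<longleftrightarrow> (AE y in p s a. fst y \<noteq> s')"
    using sets_kernel_Collect[of "\<lambda>x d. x = s'" s a]
    by (subst prob_Collect_eq_0) (auto simp: space_kernel_outcome)
  finally show ?thesis
    using AE_kernel_iff[of "\<lambda>x d. x \<noteq> s'" s a]
    by (auto simp: next_prob_def zero_less_measure_iff split_beta')
qed

text \<open>The conditional probability is a joint probability divided by that of the next state. A
  positive numerator forces a positive denominator; for a zero denominator the quotient is 0 by
  convention.\<close>

lemma damage_prob_pos_iff: "damage_prob p s a s' > 0 \<longleftrightarrow> (s', True) \<in> possible p s a"
proof -
  interpret prob_space "p s a" by (rule prob_space_kernel)
  let ?q = "\<P>(y in p s a. fst y = s' \<and> snd (snd y) = True)"
  have "next_prob p s a s' = \<P>(y in p s a. fst y = s')"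
    unfolding next_prob_def by (intro arg_cong[where f = prob]) auto
  then have "damage_prob p s a s' = ?q / next_prob p s a s'"
    by (simp add: damage_prob_def cond_prob_def split_beta' conj_commute)
  moreover have "?q > 0 \<longleftrightarrow> (s', True) \<in> possible p s a"
    by (simp add: possible_def)
  moreover have "(s', True) \<in> possible p s a \<Longrightarrow> next_prob p s a s' > 0"
    using next_prob_pos_iff by blast
  ultimately show ?thesis
    by (auto simp: zero_less_divide_iff)
qed

text \<open>The step kernel draws an outcome and then an action; splitting both draws yields
  quantifiers over the two supports. \<open>R\<close> does not see the reward, so
  \<open>possible\<close> suffices for the outcome.\<close>

lemma AE_step_kernel_iff:
  assumes x: "config_of x = (s, k, a)"
  shows "(AE y in step_kernel p \<pi> x. R (config_of y) (damage_of y)) \<longleftrightarrow>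
    (\<forall>(s', d) \<in> possible p s a. \<forall>a' \<in> set_pmf (\<pi> s' (spend k d)). R (s', spend k d, a') d)"
proof -
  obtain r0 d0 where x: "x = (s, k, a, r0, d0)"
    using x by (cases x) (auto simp: config_of_def)
  have [measurable]: "Measurable.pred step_space (\<lambda>y :: ('s, 'a) step. R (config_of y) (damage_of y))"
    by measurable
  let ?g = "\<lambda>(s', r, d). measure_pmf (\<pi> s' (spend k d)) \<bind> (\<lambda>a'. return step_space (s', spend k d, a', r, d))"
  have 1: "(\<lambda>a'. return step_space (s', spend k d, a', r, d)) \<in>
      measure_pmf (\<pi> s' (spend k d)) \<rightarrow>\<^sub>M subprob_algebra step_space" for s' r d
    by (auto simp: space_subprob_algebra prob_space_imp_subprob_space prob_space_return)
  have pmf: "(\<lambda>y. measure_pmf (\<pi> (fst y) (spend k (snd (snd y)))))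
      \<in> outcome_space \<rightarrow>\<^sub>M subprob_algebra (count_space UNIV)"
    using measurable_compose[OF measurable_outcome,
        of "\<lambda>c. measure_pmf (\<pi> (fst c) (spend k (snd c)))" "subprob_algebra (count_space UNIV)"]
    by (simp add: split_beta' space_subprob_algebra measure_pmf.subprob_space_axioms Pi_iff)
  have ret: "(\<lambda>(y, a'). return step_space (fst y, spend k (snd (snd y)), a', fst (snd y), snd (snd y)))
      \<in> outcome_space \<Otimes>\<^sub>M count_space UNIV \<rightarrow>\<^sub>M subprob_algebra (step_space :: ('s, 'a) step measure)"
    unfolding split_beta'
    by (rule measurable_compose[OF _ return_measurable])
      (unfold step_space_def outcome_space_def, measurable)
  have "?g \<in> outcome_space \<rightarrow>\<^sub>M subprob_algebra step_space"
    unfolding split_beta' by (rule measurable_bind'[OF pmf ret])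
  then have "(AE y in step_kernel p \<pi> x. R (config_of y) (damage_of y)) \<longleftrightarrow>
      (AE x in p s a. AE y in ?g x. R (config_of y) (damage_of y))"
    unfolding x step_kernel_def prod.case
    by (subst AE_bind[where B = step_space]) (simp_all add: measurable_cong_sets[OF sets_kernel_outcome refl])
  also have "\<dots> \<longleftrightarrow> (AE (s', r, d) in p s a. \<forall>a' \<in> set_pmf (\<pi> s' (spend k d)). R (s', spend k d, a') d)"
  proof (rule AE_cong, clarify)
    fix s' r d
    have ret_iff: "(AE y in return step_space (s', spend k d, a', r, d). R (config_of y) (damage_of y)) \<longleftrightarrow>
        R (s', spend k d, a') d" for a'
      by (subst AE_return) (simp_all, simp add: config_of_def damage_of_def)
    show "(AE y in measure_pmf (\<pi> s' (spend k d)) \<bind> (\<lambda>a'. return step_space (s', spend k d, a', r, d)).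
          R (config_of y) (damage_of y)) \<longleftrightarrow>
        (\<forall>a' \<in> set_pmf (\<pi> s' (spend k d)). R (s', spend k d, a') d)"
      by (subst AE_bind[OF 1]) (simp_all add: AE_measure_pmf_iff ret_iff)
  qed
  finally show ?thesis
    by (simp add: AE_kernel_iff)
qed

section \<open>Almost sure statements along the trajectory\<close>

lemma AE_trajectory_0: "AE \<omega> in trajectory p \<pi> s k a. config_of (\<omega> 0) = (s, budget_of_enat k, a)"
proof -
  interpret Ionescu_Tulcea "history_kernel p \<pi> s (budget_of_enat k) a" "\<lambda>_. step_space"
    by (rule Ionescu_Tulcea_history_kernel[OF kernel])
  have "AE \<omega> in PF.lim. config_of (restrict \<omega> {0..<Suc 0} 0) = (s, budget_of_enat k, a)"
  proof (subst AE_lim_Suc_iff)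
    show "AE \<omega> in PF.lim. AE x in history_kernel p \<pi> s (budget_of_enat k) a 0 (restrict \<omega> {0..<0}).
        config_of (((restrict \<omega> {0..<0})(0 := x)) 0) = (s, budget_of_enat k, a)"
      unfolding history_kernel_def nat.case
      by (subst AE_return) (simp_all, simp add: config_of_def)
  qed measurable
  then show ?thesis
    unfolding trajectory_def by simp
qed

text \<open>Reduces consecutive times to a combinatorial condition on supports. It serves both for
  invariants and for reachability.\<close>

lemma AE_trajectory_Suc_iff:
  "(AE \<omega> in trajectory p \<pi> s k a. R (config_of (\<omega> n)) (config_of (\<omega> (Suc n))) (damage_of (\<omega> (Suc n)))) \<longleftrightarrow>
   (AE \<omega> in trajectory p \<pi> s k a. case config_of (\<omega> n) of (s1, k1, a1) \<Rightarrow>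
      \<forall>(s', d) \<in> possible p s1 a1. \<forall>a' \<in> set_pmf (\<pi> s' (spend k1 d)).
        R (s1, k1, a1) (s', spend k1 d, a') d)"
proof -
  interpret Ionescu_Tulcea "history_kernel p \<pi> s (budget_of_enat k) a" "\<lambda>_. step_space"
    by (rule Ionescu_Tulcea_history_kernel[OF kernel])
  let ?R = "\<lambda>\<omega>. R (config_of (\<omega> n)) (config_of (\<omega> (Suc n))) (damage_of (\<omega> (Suc n)))"
  have "Measurable.pred (PiM {0..<Suc (Suc n)} (\<lambda>_. step_space)) ?R"
    by measurable
  note step = AE_lim_Suc_iff[OF this]
  \<comment> \<open>The kernel at time \<open>Suc n\<close> reads only coordinate \<open>n\<close>,
    which the restriction keeps.\<close>
  have eq: "history_kernel p \<pi> s (budget_of_enat k) a (Suc n) (restrict \<omega> {0..<Suc n}) = step_kernel p \<pi> (\<omega> n)" for \<omega>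
    by (simp add: history_kernel_def)
  have "(AE \<omega> in PF.lim. ?R \<omega>) \<longleftrightarrow>
      (AE \<omega> in PF.lim. AE y in step_kernel p \<pi> (\<omega> n). R (config_of (\<omega> n)) (config_of y) (damage_of y))"
    using step unfolding eq by simp
  also have "\<dots> \<longleftrightarrow> (AE \<omega> in PF.lim. case config_of (\<omega> n) of (s1, k1, a1) \<Rightarrow>
      \<forall>(s', d) \<in> possible p s1 a1. \<forall>a' \<in> set_pmf (\<pi> s' (spend k1 d)).
        R (s1, k1, a1) (s', spend k1 d, a') d)"
    by (intro AE_cong) (auto simp: AE_step_kernel_iff split: prod.split)
  finally show ?thesis
    unfolding trajectory_def .
qed


section \<open>The budget recursion\<close>

lemma possible_nonempty: "possible p s a \<noteq> {}"
proof
  interpret prob_space "p s a" by (rule prob_space_kernel)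
  assume "possible p s a = {}"
  then have "AE y in p s a. False"
    using AE_kernel_iff[of "\<lambda>_ _. False" s a] by (simp add: split_beta')
  then show False
    by simp
qed

lemma budget_iter_Suc_eq:
  "budget_iter p (Suc n) s a = (MAX s' \<in> fst ` possible p s a.
    of_bool ((s', True) \<in> possible p s a) + (MIN a'. budget_iter p n s' a'))"
proof -
  have "{s'. next_prob p s a s' > 0} = fst ` possible p s a"
    by (force simp: next_prob_pos_iff)
  then show ?thesis
    by (simp add: damage_prob_pos_iff)
qed

lemma budget_iter_argmin: "\<exists>a'. budget_iter p n s' a' = (MIN a'. budget_iter p n s' a')"
  using Min_in[of "range (budget_iter p n s')"] by (auto simp: image_iff)

text \<open>The damage \<open>d\<close> is at most the indicator in the recursion, so a minimizing
  action works. Together with \<open>budget_iter_Suc_upper\<close> this replaces the maximum by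
  single transitions.\<close>

lemma budget_iter_Suc_lower:
  assumes "(s', d) \<in> possible p s a"
  shows "\<exists>a'. of_bool d + budget_iter p n s' a' \<le> budget_iter p (Suc n) s a"
proof -
  obtain a' where a': "budget_iter p n s' a' = (MIN a'. budget_iter p n s' a')"
    using budget_iter_argmin by blast
  have "of_bool d + budget_iter p n s' a'
      \<le> of_bool ((s', True) \<in> possible p s a) + (MIN a'. budget_iter p n s' a')"
    using assms unfolding a' by (intro add_right_mono) auto
  also have "\<dots> \<le> budget_iter p (Suc n) s a"
    unfolding budget_iter_Suc_eq using assms by (intro Max_ge) force+
  finally show ?thesis by blast
qed

lemma budget_iter_Suc_upper:
  assumes "\<And>s' d. (s', d) \<in> possible p s a \<Longrightarrow> \<exists>a'. of_bool d + budget_iter p n s' a' \<le> k"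
  shows "budget_iter p (Suc n) s a \<le> k"
  unfolding budget_iter_Suc_eq
proof (intro Max.boundedI)
  fix x assume "x \<in> (\<lambda>s'. of_bool ((s', True) \<in> possible p s a) + (MIN a'. budget_iter p n s' a'))
      ` fst ` possible p s a"
  then obtain s' d where sd: "(s', d) \<in> possible p s a"
    and x: "x = of_bool ((s', True) \<in> possible p s a) + (MIN a'. budget_iter p n s' a')"
    by auto
  \<comment> \<open>The worst damage value at \<open>s'\<close> is itself a possible outcome: if
    damage is impossible, the given outcome must carry \<open>d = False\<close>.\<close>
  have "(s', (s', True) \<in> possible p s a) \<in> possible p s a"
    using sd by (cases d; cases "(s', True) \<in> possible p s a") auto
  from assms[OF this] obtain a' where
    "of_bool ((s', True) \<in> possible p s a) + budget_iter p n s' a' \<le> k" by blast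
  moreover have "(MIN a'. budget_iter p n s' a') \<le> budget_iter p n s' a'"
    by (rule Min_le) auto
  ultimately show "x \<le> k"
    unfolding x by (meson add_left_mono order_trans)
qed (use possible_nonempty in auto)

text \<open>The recursion is monotone in the previous iterate, and it starts from the constant 0,
  the least value.\<close>

lemma incseq_budget_iter: "incseq (\<lambda>n. budget_iter p n s a)"
proof (rule incseq_SucI)
  show "budget_iter p n s a \<le> budget_iter p (Suc n) s a" for n
  proof (induction n arbitrary: s a)
    case (Suc n)
    show ?case
    proof (rule budget_iter_Suc_upper)
      fix s' d assume "(s', d) \<in> possible p s a"
      then obtain a' where "of_bool d + budget_iter p (Suc n) s' a' \<le> budget_iter p (Suc (Suc n)) s a"
        using budget_iter_Suc_lower by blast
      then show "\<exists>a'. of_bool d + budget_iter p n s' a' \<le> budget_iter p (Suc (Suc n)) s a"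
        using Suc.IH by (meson add_left_mono order_trans)
    qed
  qed simp
qed

definition budget_limit :: "'s \<Rightarrow> 'a \<Rightarrow> enat" where
  "budget_limit s a = (SUP n. budget_iter p n s a)"

text \<open>The minimizing action may change with \<open>n\<close>. Since actions are finitely many
  and the iterates increase, one action meets the bound for all \<open>n\<close>, and the supremum
  can be taken afterwards.\<close>

lemma budget_limit_lower:
  assumes "(s', d) \<in> possible p s a"
  shows "\<exists>a'. of_bool d + budget_limit s' a' \<le> budget_limit s a"
proof -
  have "\<exists>a'. \<forall>n. of_bool d + budget_iter p n s' a' \<le> budget_limit s a"
  proof (rule ccontr)
    assume "\<not> ?thesis"
    \<comment> \<open>\<open>N a'\<close> is an index at which \<open>a'\<close> violates the bound;
      by monotonicity every action would violate it at the largest of these indices.\<close>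
    then obtain N where N: "\<And>a'. \<not> of_bool d + budget_iter p (N a') s' a' \<le> budget_limit s a"
      by metis
    obtain a' where "of_bool d + budget_iter p (Max (range N)) s' a' \<le> budget_iter p (Suc (Max (range N))) s a"
      using budget_iter_Suc_lower[OF assms] by blast
    also have "\<dots> \<le> budget_limit s a"
      unfolding budget_limit_def by (rule SUP_upper) simp
    finally have "of_bool d + budget_iter p (Max (range N)) s' a' \<le> budget_limit s a" .
    moreover have "budget_iter p (N a') s' a' \<le> budget_iter p (Max (range N)) s' a'"
      by (rule incseqD[OF incseq_budget_iter]) simp
    ultimately show False
      using N[of a'] by (meson add_left_mono order_trans)
  qed
  then obtain a' where a': "\<And>n. of_bool d + budget_iter p n s' a' \<le> budget_limit s a"
    by blast
  \<comment> \<open>For \<open>d\<close> true, adding 1 is \<open>eSuc\<close>, which commutes with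
    the supremum of a nonempty set.\<close>
  have "of_bool d + budget_limit s' a' = (SUP n. of_bool d + budget_iter p n s' a')"
    by (cases d) (simp_all add: budget_limit_def plus_1_eSuc eSuc_Sup image_image)
  also have "\<dots> \<le> budget_limit s a"
    by (rule SUP_least) (rule a')
  finally show ?thesis by blast
qed

section \<open>Safe policies\<close>

text \<open>By \<open>barrier_eq\<close> this is exactly the case in which the barrier is 0.\<close>

abbreviation safe :: "('s, 'a) policy \<Rightarrow> 's \<Rightarrow> enat \<Rightarrow> 'a \<Rightarrow> bool" where
  "safe \<pi> s k a \<equiv> AE \<omega> in trajectory p \<pi> s k a.
    (\<Sum>l. of_bool (damage_of (\<omega> (Suc l)))) \<le> ennreal_of_enat k"

lemma suminf_of_bool_le_iff:
  "(\<Sum>l. of_bool (D l) :: ennreal) \<le> ennreal_of_enat (enat k) \<longleftrightarrow> (\<forall>n. (\<Sum>l<n. of_bool (D l)) \<le> k)"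
proof -
  have "(\<Sum>l<n. of_bool (D l) :: ennreal) = of_nat (\<Sum>l<n. of_bool (D l))" for n
    by simp
  then show ?thesis
    unfolding suminf_eq_SUP SUP_le_iff ennreal_of_enat_enat by (simp only: of_nat_le_iff) simp
qed

text \<open>The spending rule holds almost surely at each time, hence at all times at once by
  countability; along such a path the formula follows by induction.\<close>

lemma AE_budget:
  "AE \<omega> in trajectory p \<pi> s (enat k) a. \<forall>n.
    fst (snd (config_of (\<omega> n))) = Finite_Budget (int k - int (\<Sum>l<n. of_bool (damage_of (\<omega> (Suc l)))))"
proof -
  have "AE \<omega> in trajectory p \<pi> s (enat k) a. \<forall>n.
      fst (snd (config_of (\<omega> (Suc n)))) = spend (fst (snd (config_of (\<omega> n)))) (damage_of (\<omega> (Suc n)))"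
  proof (subst AE_all_countable, rule allI)
    fix n
    show "AE \<omega> in trajectory p \<pi> s (enat k) a.
      fst (snd (config_of (\<omega> (Suc n)))) = spend (fst (snd (config_of (\<omega> n)))) (damage_of (\<omega> (Suc n)))"
      by (subst AE_trajectory_Suc_iff[where R = "\<lambda>c c' d. fst (snd c') = spend (fst (snd c)) d"])
        (auto split: prod.split)
  qed
  with AE_trajectory_0[where \<pi> = \<pi> and s = s and k = "enat k" and a = a] show ?thesis
  proof eventually_elim
    case (elim \<omega>)
    show ?case
    proof
      fix n
      show "fst (snd (config_of (\<omega> n))) =
          Finite_Budget (int k - int (\<Sum>l<n. of_bool (damage_of (\<omega> (Suc l)))))"
        using elim by (induction n) simp_all
    qed
  qed
qed

text \<open>By \<open>AE_budget\<close> the running budget is \<open>k\<close> minus the partial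
  damage, so a bound on total damage becomes a condition on single configurations.\<close>

lemma safe_iff_AE_budget_nonneg:
  "safe \<pi> s (enat k) a \<longleftrightarrow>
    (AE \<omega> in trajectory p \<pi> s (enat k) a. \<forall>n b. fst (snd (config_of (\<omega> n))) = Finite_Budget b \<longrightarrow> 0 \<le> b)"
  (is "?L \<longleftrightarrow> ?R")
proof -
  have "AE \<omega> in trajectory p \<pi> s (enat k) a.
      (\<Sum>l. of_bool (damage_of (\<omega> (Suc l)))) \<le> ennreal_of_enat (enat k) \<longleftrightarrow>
      (\<forall>n b. fst (snd (config_of (\<omega> n))) = Finite_Budget b \<longrightarrow> 0 \<le> b)"
    using AE_budget[where \<pi> = \<pi> and s = s and k = k and a = a]
  proof eventually_elim
    case (elim \<omega>)
    then show ?case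
      unfolding suminf_of_bool_le_iff by (simp only: elim) (simp del: of_nat_sum)
  qed
  then show ?thesis
    by (rule eventually_subst)
qed

section \<open>Reachable configurations and the lower bound\<close>

text \<open>Positive probability, phrased as failure of almost sure avoidance so that
  \<open>AE_trajectory_Suc_iff\<close> applies directly.\<close>

definition reachable :: "('s, 'a) policy \<Rightarrow> 's \<Rightarrow> enat \<Rightarrow> 'a \<Rightarrow> nat \<Rightarrow> 's \<times> budget \<times> 'a \<Rightarrow> bool" where
  "reachable \<pi> s k a n c \<longleftrightarrow> \<not> (AE \<omega> in trajectory p \<pi> s k a. config_of (\<omega> n) \<noteq> c)"

lemma reachable_0: "reachable \<pi> s k a 0 (s, budget_of_enat k, a)"
proof -
  interpret prob_space "trajectory p \<pi> s k a"
    by (rule prob_space_trajectory[OF kernel])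
  show ?thesis
    unfolding reachable_def
  proof
    assume "AE \<omega> in trajectory p \<pi> s k a. config_of (\<omega> 0) \<noteq> (s, budget_of_enat k, a)"
    with AE_trajectory_0[where \<pi> = \<pi> and s = s and k = k and a = a] have "AE \<omega> in trajectory p \<pi> s k a. False"
      by eventually_elim simp
    then show False by simp
  qed
qed

text \<open>By contraposition: almost surely avoiding the successor forces almost surely avoiding
  each configuration that can lead to it in one step.\<close>

lemma reachable_Suc:
  assumes c: "reachable \<pi> s k a n (s1, k1, a1)"
    and s': "(s', d) \<in> possible p s1 a1" and a': "a' \<in> set_pmf (\<pi> s' (spend k1 d))"
  shows "reachable \<pi> s k a (Suc n) (s', spend k1 d, a')"
  unfolding reachable_def
proof
  assume "AE \<omega> in trajectory p \<pi> s k a. config_of (\<omega> (Suc n)) \<noteq> (s', spend k1 d, a')"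
  from this[unfolded AE_trajectory_Suc_iff[where R = "\<lambda>c c' e. c' \<noteq> (s', spend k1 d, a')"]]
  have "AE \<omega> in trajectory p \<pi> s k a. config_of (\<omega> n) \<noteq> (s1, k1, a1)"
    by eventually_elim (use s' a' in \<open>auto split: prod.splits\<close>)
  with c show False
    by (simp add: reachable_def)
qed

lemma budget_iter_le_if_safe:
  assumes "safe \<pi> s k a"
  shows "budget_iter p n s a \<le> k"
proof (cases k)
  case (enat k')
  have nonneg: "0 \<le> b" if c: "reachable \<pi> s k a m (s1, Finite_Budget b, a1)" for m s1 b a1
  proof (rule ccontr)
    assume "\<not> 0 \<le> b"
    have "AE \<omega> in trajectory p \<pi> s k a. config_of (\<omega> m) \<noteq> (s1, Finite_Budget b, a1)"
      using assms[unfolded enat safe_iff_AE_budget_nonneg, folded enat]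
      by eventually_elim (metis fst_conv snd_conv \<open>\<not> 0 \<le> b\<close>)
    with c show False
      by (simp add: reachable_def)
  qed
  have "budget_iter p n s1 a1 \<le> enat (nat b)" if "reachable \<pi> s k a m (s1, Finite_Budget b, a1)" for m s1 b a1
    using that
  proof (induction n arbitrary: m s1 b a1)
    case (Suc n)
    show ?case
    proof (rule budget_iter_Suc_upper)
      fix s' d assume s': "(s', d) \<in> possible p s1 a1"
      \<comment> \<open>\<open>budget_iter_Suc_upper\<close> asks for only one action, so any action
        that the policy plays with positive probability will do.\<close>
      obtain a' where "a' \<in> set_pmf (\<pi> s' (spend (Finite_Budget b) d))"
        using set_pmf_not_empty by fast
      from reachable_Suc[OF Suc.prems s' this]
      have r: "reachable \<pi> s k a (Suc m) (s', Finite_Budget (b - of_bool d), a')"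
        by simp
      have "of_bool d + budget_iter p n s' a' \<le> of_bool d + enat (nat (b - of_bool d))"
        by (intro add_left_mono Suc.IH[OF r])
      \<comment> \<open>The successor is reachable, so its budget is nonnegative and
        \<open>nat\<close> does not truncate; in particular damage requires \<open>b\<close> to be
        at least 1.\<close>
      also have "\<dots> = enat (nat b)"
        using nonneg[OF r] by (cases d) (auto simp: one_enat_def)
      finally show "\<exists>a'. of_bool d + budget_iter p n s' a' \<le> enat (nat b)" by blast
    qed
  qed simp
  from this[of 0 s "int k'" a] show ?thesis
    using reachable_0[where \<pi> = \<pi> and s = s and k = k and a = a] by (simp add: enat)
qed simp

section \<open>The greedy policy and the upper bound\<close>

lemma safe_policy_exists: "\<exists>\<pi>. safe \<pi> s (budget_limit s a) a"
proof (cases "budget_limit s a")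
  case (enat k)
  have "\<exists>b. \<forall>a'. budget_limit s' b \<le> budget_limit s' a'" for s'
  proof -
    obtain b where "budget_limit s' b = Min (range (budget_limit s'))"
      using Min_in[of "range (budget_limit s')"] by (auto simp: image_iff)
    then have "budget_limit s' b \<le> budget_limit s' a'" for a'
      by simp
    then show ?thesis by blast
  qed
  then obtain g where g: "\<And>s' a'. budget_limit s' (g s') \<le> budget_limit s' a'"
    by metis
  define \<pi> :: "('s, 'a) policy" where "\<pi> = (\<lambda>s' _. return_pmf (g s'))"
  \<comment> \<open>The prescribed first action need not be greedy, so the budget is compared with
    the limit at the current action. It is an inequality because the budget may later exceed that
    limit.\<close>
  define inv where "inv = (\<lambda>(s1, k1, a1). \<exists>b\<ge>0. k1 = Finite_Budget b \<and> budget_limit s1 a1 \<le> enat (nat b))"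
  have inv_step: "inv (s', spend k1 d, g s')" if inv: "inv (s1, k1, a1)" and s': "(s', d) \<in> possible p s1 a1" for s1 k1 a1 s' d
  proof -
    obtain b where b: "b \<ge> 0" "k1 = Finite_Budget b" "budget_limit s1 a1 \<le> enat (nat b)"
      using inv by (auto simp: inv_def)
    obtain a' where "of_bool d + budget_limit s' a' \<le> budget_limit s1 a1"
      using budget_limit_lower[OF s'] by blast
    then have *: "of_bool d + budget_limit s' (g s') \<le> enat (nat b)"
      using g[of s' a'] b(3) by (meson add_left_mono order_trans)
    then obtain m where m: "budget_limit s' (g s') = enat m"
      by (cases "budget_limit s' (g s')") auto
    show ?thesis
      using * b(1) unfolding inv_def m by (cases d) (auto simp: b(2) m one_enat_def)
  qed
  have "AE \<omega> in trajectory p \<pi> s (enat k) a. \<forall>n. inv (config_of (\<omega> n)) \<longrightarrow> inv (config_of (\<omega> (Suc n)))"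
  proof (subst AE_all_countable, rule allI)
    fix n
    show "AE \<omega> in trajectory p \<pi> s (enat k) a. inv (config_of (\<omega> n)) \<longrightarrow> inv (config_of (\<omega> (Suc n)))"
      by (subst AE_trajectory_Suc_iff[where R = "\<lambda>c c' d. inv c \<longrightarrow> inv c'"])
        (auto simp: \<pi>_def inv_step split: prod.split)
  qed
  with AE_trajectory_0[where \<pi> = \<pi> and s = s and k = "enat k" and a = a]
  have "AE \<omega> in trajectory p \<pi> s (enat k) a. \<forall>n b. fst (snd (config_of (\<omega> n))) = Finite_Budget b \<longrightarrow> 0 \<le> b"
  proof eventually_elim
    case (elim \<omega>)
    have "inv (config_of (\<omega> n))" for n
      using elim by (induction n) (auto simp: inv_def enat)
    moreover have "0 \<le> b" if "inv c" "fst (snd c) = Finite_Budget b" for c b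
      using that by (cases c) (auto simp: inv_def)
    ultimately show ?case
      by blast
  qed
  then show ?thesis
    unfolding enat safe_iff_AE_budget_nonneg by blast
qed simp

text \<open>Every barrier is 0 or -\<infinity> and the supremum is attained, so it vanishes exactly
  when some policy has barrier 0.\<close>

lemma opt_barrier_eq_0_iff: "opt_barrier p s k a = 0 \<longleftrightarrow> (\<exists>\<pi>. safe \<pi> s k a)"
proof
  assume "opt_barrier p s k a = 0"
  moreover have "\<exists>\<pi>. barrier p \<pi> s k a = opt_barrier p s k a"
    by (rule opt_barrier_attained[OF kernel])
  ultimately obtain \<pi> where "barrier p \<pi> s k a = 0"
    by auto
  then have "safe \<pi> s k a"
    by (auto simp: barrier_eq[OF kernel] split: if_splits)
  then show "\<exists>\<pi>. safe \<pi> s k a"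
    by blast
next
  assume "\<exists>\<pi>. safe \<pi> s k a"
  then obtain \<pi> where "barrier p \<pi> s k a = 0"
    by (auto simp: barrier_eq[OF kernel])
  moreover have "barrier p \<pi>' s k a \<le> 0" for \<pi>'
    by (simp add: barrier_eq[OF kernel])
  ultimately show "opt_barrier p s k a = 0"
    unfolding opt_barrier_def by (intro antisym SUP_least) (simp, metis SUP_upper UNIV_I)
qed

text \<open>The limit is an admissible budget by \<open>safe_policy_exists\<close>, and any safe
  budget bounds all iterates, hence their supremum.\<close>

lemma min_budget_eq_budget_limit: "min_budget p s a = budget_limit s a"
  unfolding min_budget_def
proof (rule Least_equality)
  show "opt_barrier p s (budget_limit s a) a = 0"
    using safe_policy_exists by (simp add: opt_barrier_eq_0_iff)
next
  fix k assume "opt_barrier p s k a = 0"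
  then show "budget_limit s a \<le> k"
    unfolding budget_limit_def opt_barrier_eq_0_iff
    by (auto intro!: SUP_least intro: budget_iter_le_if_safe)
qed

lemma budget_iter_tendsto_min_budget: "(\<lambda>n. budget_iter p n s a) \<longlonglongrightarrow> min_budget p s a"
  unfolding min_budget_eq_budget_limit budget_limit_def
  by (rule LIMSEQ_SUP[OF incseq_budget_iter])

end

theorem theorem12:
  fixes p :: "('s :: finite, 'a :: finite) kernel" and z :: 's
    and s :: 's and a :: 'a
  assumes "cmdp p z"
  shows "(\<lambda>n. budget_iter p n s a) \<longlonglongrightarrow> min_budget p s a"
  using cmdp.kernel[OF assms] by (rule budget_iter_tendsto_min_budget)

end
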